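(* Let $G$ be a discrete, finitely generated, residually finite group. If $G$ is a discrete, countable, and amenable group, then every $G$ odometer action has zero entropy.
   Context: A $G$ odometer is defined by a sequence $\Gamma_1\supset\Gamma_2\supset\cdots$ of finite index normal subgroups of $G$ with $\bigcap_n\Gamma_n=\{e\}$: it is the action of $G$ by left multiplication on the inverse limit $\overleftarrow{G/\Gamma_n}$ of the finite groups $G/\Gamma_n$ under the natural quotient maps, equipped with Haar probability measure $\mu$, which is invariant. Entropy is the measure-theoretic entropy (Kolmogorov–Sinai, in the sense of Ornstein–Weiss) of the measure preserving action of the amenable group $G$ on $(\overleftarrow{G/\Gamma_n},\mu)$. *)

theory Defs
  imports "HOL-Algebra.Algebra" "HOL-Analysis.Analysis" "HOL-Probability.Probability"
begin

section \<open>Groups\<close>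

definition finitely_generated :: "('a, 'b) monoid_scheme \<Rightarrow> bool" where
  "finitely_generated G \<longleftrightarrow> (\<exists>S. finite S \<and> S \<subseteq> carrier G \<and> generate G S = carrier G)"

definition finite_index_normal :: "('a, 'b) monoid_scheme \<Rightarrow> 'a set \<Rightarrow> bool" where
  "finite_index_normal G N \<longleftrightarrow> N \<lhd> G \<and> finite (rcosets\<^bsub>G\<^esub> N)"

definition residually_finite :: "('a, 'b) monoid_scheme \<Rightarrow> bool" where
  "residually_finite G \<longleftrightarrow>
     (\<forall>g\<in>carrier G - {\<one>\<^bsub>G\<^esub>}. \<exists>N. finite_index_normal G N \<and> g \<notin> N)"

text \<open>Amenability of a discrete group is Folner's condition; for countable groups it
  provides Folner sequences, along which Ornstein--Weiss entropy is computed.\<close>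

definition amenable :: "('a, 'b) monoid_scheme \<Rightarrow> bool" where
  "amenable G \<longleftrightarrow>
     (\<forall>K \<epsilon>. finite K \<and> K \<subseteq> carrier G \<and> \<epsilon> > (0::real) \<longrightarrow>
        (\<exists>F. finite F \<and> F \<noteq> {} \<and> F \<subseteq> carrier G \<and>
             (\<forall>g\<in>K. real (card (sym_diff (g <#\<^bsub>G\<^esub> F) F)) \<le> \<epsilon> * real (card F))))"

definition folner_sequence :: "('a, 'b) monoid_scheme \<Rightarrow> (nat \<Rightarrow> 'a set) \<Rightarrow> bool" where
  "folner_sequence G F \<longleftrightarrow>
     (\<forall>n. finite (F n) \<and> F n \<noteq> {} \<and> F n \<subseteq> carrier G) \<and>
     (\<forall>g\<in>carrier G.
        (\<lambda>n. real (card (sym_diff (g <#\<^bsub>G\<^esub> F n) (F n))) / real (card (F n))) \<longlonglongrightarrow> 0)"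


section \<open>Entropy of a measure preserving action\<close>

definition finite_measurable_partition :: "'x measure \<Rightarrow> 'x set set \<Rightarrow> bool" where
  "finite_measurable_partition M P \<longleftrightarrow>
     finite P \<and> P \<subseteq> sets M \<and> partition_on (space M) P"

definition partition_entropy :: "'x measure \<Rightarrow> 'x set set \<Rightarrow> real" where
  "partition_entropy M P = - (\<Sum>A\<in>P. measure M A * ln (measure M A))"

text \<open>The join of the partitions \<open>g\<^sup>-\<^sup>1 P\<close> over \<open>g \<in> F\<close>: its members are the nonempty
  intersections of sets \<open>g\<^sup>-\<^sup>1 (A g)\<close> for a choice \<open>A g \<in> P\<close>.\<close>

definition action_join ::
  "'x measure \<Rightarrow> ('a \<Rightarrow> 'x \<Rightarrow> 'x) \<Rightarrow> 'a set \<Rightarrow> 'x set set \<Rightarrow> 'x set set" where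
  "action_join M act F P =
     (\<lambda>A. {x \<in> space M. \<forall>g\<in>F. act g x \<in> A g}) ` (F \<rightarrow>\<^sub>E P) - {{}}"

text \<open>By the Ornstein--Weiss theorem, for an action of a countable amenable group the limit
  below exists along every Folner sequence and does not depend on the sequence; the
  entropy of the partition is this common value.\<close>

definition partition_action_entropy ::
  "('a, 'b) monoid_scheme \<Rightarrow> 'x measure \<Rightarrow> ('a \<Rightarrow> 'x \<Rightarrow> 'x) \<Rightarrow> 'x set set \<Rightarrow> real" where
  "partition_action_entropy G M act P =
     (THE h. \<forall>F. folner_sequence G F \<longrightarrow>
        (\<lambda>n. partition_entropy M (action_join M act (F n) P) / real (card (F n))) \<longlonglongrightarrow> h)"

definition action_entropy ::
  "('a, 'b) monoid_scheme \<Rightarrow> 'x measure \<Rightarrow> ('a \<Rightarrow> 'x \<Rightarrow> 'x) \<Rightarrow> ereal" where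
  "action_entropy G M act =
     (SUP P\<in>{P. finite_measurable_partition M P}. ereal (partition_action_entropy G M act P))"


section \<open>Odometers\<close>

text \<open>The inclusions need not be strict, but the sequence must not stabilise (for strict
  inclusions this is automatic). A stabilising sequence with trivial intersection exists only
  if \<open>G\<close> is finite; the odometer is then \<open>G\<close> acting on itself, which has entropy
  \<open>ln |G| / |G|\<close>.\<close>

definition odometer_sequence :: "('a, 'b) monoid_scheme \<Rightarrow> (nat \<Rightarrow> 'a set) \<Rightarrow> bool" where
  "odometer_sequence G \<Gamma> \<longleftrightarrow>
     (\<forall>n. finite_index_normal G (\<Gamma> n)) \<and>
     (\<forall>n. \<Gamma> (Suc n) \<subseteq> \<Gamma> n) \<and>
     (\<forall>n. \<exists>m>n. \<Gamma> m \<noteq> \<Gamma> n) \<and>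
     (\<Inter>n. \<Gamma> n) = {\<one>\<^bsub>G\<^esub>}"

text \<open>The natural quotient map from \<open>G Mod \<Gamma> (Suc n)\<close> to \<open>G Mod \<Gamma> n\<close> sends a coset \<open>C\<close>
  of \<open>\<Gamma> (Suc n)\<close> to the coset \<open>\<Gamma> n <#> C\<close> of \<open>\<Gamma> n\<close> containing it.\<close>

definition odometer_space ::
  "('a, 'b) monoid_scheme \<Rightarrow> (nat \<Rightarrow> 'a set) \<Rightarrow> (nat \<Rightarrow> 'a set) set" where
  "odometer_space G \<Gamma> =
     {x \<in> (\<Pi>\<^sub>E n\<in>UNIV. carrier (G Mod \<Gamma> n)). \<forall>n. x n = \<Gamma> n <#>\<^bsub>G\<^esub> x (Suc n)}"

definition odometer_group ::
  "('a, 'b) monoid_scheme \<Rightarrow> (nat \<Rightarrow> 'a set) \<Rightarrow> (nat \<Rightarrow> 'a set) monoid" where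
  "odometer_group G \<Gamma> =
     (product_group UNIV (\<lambda>n. G Mod \<Gamma> n))\<lparr>carrier := odometer_space G \<Gamma>\<rparr>"

definition odometer_topology ::
  "('a, 'b) monoid_scheme \<Rightarrow> (nat \<Rightarrow> 'a set) \<Rightarrow> (nat \<Rightarrow> 'a set) topology" where
  "odometer_topology G \<Gamma> =
     subtopology (product_topology (\<lambda>n. discrete_topology (carrier (G Mod \<Gamma> n))) UNIV)
       (odometer_space G \<Gamma>)"

definition odometer_action ::
  "('a, 'b) monoid_scheme \<Rightarrow> 'a \<Rightarrow> (nat \<Rightarrow> 'a set) \<Rightarrow> (nat \<Rightarrow> 'a set)" where
  "odometer_action G g x = (\<lambda>n. g <#\<^bsub>G\<^esub> x n)"

text \<open>Haar probability measure of a compact metrizable group \<open>K\<close> with topology \<open>T\<close>. Regularity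
  is not required explicitly because it holds for every Borel probability measure on a compact
  metrizable space.\<close>

definition haar_probability ::
  "('k, 'm) monoid_scheme \<Rightarrow> 'k topology \<Rightarrow> 'k measure \<Rightarrow> bool" where
  "haar_probability K T M \<longleftrightarrow>
     prob_space M \<and>
     space M = topspace T \<and>
     sets M = sigma_sets (topspace T) {U. openin T U} \<and>
     (\<forall>k\<in>carrier K. \<forall>A\<in>sets M. emeasure M (k <#\<^bsub>K\<^esub> A) = emeasure M A)"

end

theory Submission
  imports Defs
begin

text \<open>
  The odometer is the inverse limit of its finite factors \<open>G/\<Gamma>\<^sub>m\<close>, and these carry no
  entropy: whatever the finite set \<open>F\<close>, the point of \<open>G/\<Gamma>\<^sub>m\<close> below \<open>x\<close> determines the points
  below all \<open>g x\<close> with \<open>g \<in> F\<close>. If a partition depends on the coordinate \<open>x m\<close> alone, the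
  name of \<open>x\<close> along \<open>F\<close>, that is the family of its members containing the points \<open>g x\<close>,
  therefore takes at most \<open>[G : \<Gamma>\<^sub>m]\<close> values, and its entropy is at most
  \<open>ln [G : \<Gamma>\<^sub>m]\<close>. After division by \<open>|F|\<close> this contributes nothing in the limit, because
  the members of a Folner sequence of an infinite group grow without bound
  (\<open>folner_sequence_card_at_top\<close>).

  An arbitrary finite measurable partition \<open>P\<close> is not measurable with respect to a finite level,
  but it is nearly so. Cylinders form an algebra that generates the Borel sets, hence for large
  \<open>m\<close> some guess computed from the coordinate \<open>x m\<close> gives the member of \<open>P\<close> containing \<open>x\<close>
  except on a set of small measure (\<open>partition_predictable_from_level\<close>). A name along \<open>F\<close> can
  then be encoded by a point of \<open>G/\<Gamma>\<^sub>m\<close> together with the corrections to the guessed letters.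
  As the action preserves \<open>\<mu>\<close>, the expected number of corrections is \<open>|F|\<close> times the measure of
  the error set, so the corrections cost an arbitrarily small amount per element of \<open>F\<close>
  (\<open>entropy_action_join_le_finite_factor\<close>).

  That the cost of any code bounds the entropy is Gibbs' inequality. Since the
  bound holds along every Folner sequence, and since amenability of a countable group supplies at
  least one, the limit defining the entropy of \<open>P\<close> exists and equals \<open>0\<close>.
\<close>

section \<open>Entropy estimates by coding\<close>

text \<open>Relative entropy is nonnegative because \<open>ln t \<le> t - 1\<close>, applied to each ratio
  \<open>q i / p i\<close>. Coding a source \<open>p\<close> with the code lengths of another distribution \<open>q\<close> therefore
  never beats the entropy of \<open>p\<close>.\<close>

lemma gibbs_inequality:
  fixes p q :: "'i \<Rightarrow> real"
  assumes "finite I" and p: "\<And>i. i \<in> I \<Longrightarrow> 0 \<le> p i" and q: "\<And>i. i \<in> I \<Longrightarrow> 0 < q i"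
    and le: "sum q I \<le> sum p I"
  shows "- (\<Sum>i\<in>I. p i * ln (p i)) \<le> (\<Sum>i\<in>I. p i * - ln (q i))"
proof -
  have "p i * - ln (p i) - p i * - ln (q i) \<le> q i - p i" if "i \<in> I" for i
  proof (cases "p i = 0")
    case True
    with q[OF that] show ?thesis by simp
  next
    case False
    with p[OF that] have pos: "p i > 0" by simp
    have "p i * (ln (q i / p i)) \<le> p i * (q i / p i - 1)"
      using pos q[OF that] by (intro mult_left_mono ln_le_minus_one) auto
    also have "\<dots> = q i - p i"
      using pos by (simp add: field_simps)
    finally show ?thesis
      using pos q[OF that] by (simp add: ln_div algebra_simps)
  qed
  then have "(\<Sum>i\<in>I. p i * - ln (p i) - p i * - ln (q i)) \<le> (\<Sum>i\<in>I. q i - p i)"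
    by (rule sum_mono)
  with le show ?thesis
    by (simp add: sum_subtractf sum_negf)
qed

lemma partition_entropy_nonneg:
  assumes "prob_space M"
  shows "0 \<le> partition_entropy M P"
proof -
  interpret prob_space M by fact
  have "prob A * ln (prob A) \<le> 0" for A
    by (cases "prob A = 0")
       (auto intro!: mult_nonneg_nonpos simp: ln_le_zero_iff zero_less_measure_iff)
  then show ?thesis
    unfolding partition_entropy_def by (simp add: sum_nonpos)
qed

text \<open>The members of the join are indexed here by the names \<open>A\<close> that select them, empty members
  included, so that sums over the join factor over \<open>F\<close>.\<close>

definition name_set :: "'x measure \<Rightarrow> ('a \<Rightarrow> 'x \<Rightarrow> 'x) \<Rightarrow> 'a set \<Rightarrow> ('a \<Rightarrow> 'x set) \<Rightarrow> 'x set" where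
  "name_set M act F A = {x \<in> space M. \<forall>g\<in>F. act g x \<in> A g}"

lemma name_set_unique:
  assumes P: "partition_on (space M) P"
    and A: "A \<in> F \<rightarrow>\<^sub>E P" "x \<in> name_set M act F A"
    and B: "B \<in> F \<rightarrow>\<^sub>E P" "x \<in> name_set M act F B"
  shows "A = B"
proof (rule PiE_ext[OF A(1) B(1)])
  fix g assume "g \<in> F"
  with A B have "A g \<in> P" "B g \<in> P" "act g x \<in> A g" "act g x \<in> B g"
    by (auto simp: name_set_def)
  then show "A g = B g"
    using P unfolding partition_on_def disjoint_def by blast
qed

lemma name_set_exists:
  assumes P: "partition_on (space M) P" and x: "x \<in> space M"
    and act: "\<And>g. g \<in> F \<Longrightarrow> act g x \<in> space M"
  shows "\<exists>A \<in> F \<rightarrow>\<^sub>E P. x \<in> name_set M act F A"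
proof -
  have "\<exists>B\<in>P. act g x \<in> B" if "g \<in> F" for g
    using act[OF that] P by (auto simp: partition_on_def)
  then obtain A where "\<And>g. g \<in> F \<Longrightarrow> A g \<in> P \<and> act g x \<in> A g"
    by metis
  then show ?thesis
    using x by (intro bexI[of _ "restrict A F"]) (auto simp: name_set_def)
qed

lemma partition_entropy_action_join:
  assumes P: "partition_on (space M) P" "finite P" and F: "finite F"
  shows "partition_entropy M (action_join M act F P) =
    - (\<Sum>A\<in>F \<rightarrow>\<^sub>E P. measure M (name_set M act F A) * ln (measure M (name_set M act F A)))"
proof -
  let ?N = "{A \<in> F \<rightarrow>\<^sub>E P. name_set M act F A \<noteq> {}}"
  have fin: "finite (F \<rightarrow>\<^sub>E P)"
    using P F by (simp add: finite_PiE)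
  have join: "action_join M act F P = name_set M act F ` ?N"
    by (auto simp: action_join_def name_set_def)
  have "inj_on (name_set M act F) ?N"
  proof (rule inj_onI)
    fix A B assume A: "A \<in> ?N" and B: "B \<in> ?N" and eq: "name_set M act F A = name_set M act F B"
    then obtain x where "x \<in> name_set M act F A" "x \<in> name_set M act F B" by blast
    with A B show "A = B" by (intro name_set_unique[OF P(1), of A F x act B]) simp_all
  qed
  then have "(\<Sum>B\<in>action_join M act F P. measure M B * ln (measure M B)) =
      (\<Sum>A\<in>?N. measure M (name_set M act F A) * ln (measure M (name_set M act F A)))"
    unfolding join by (simp add: sum.reindex)
  also have "\<dots> = (\<Sum>A\<in>F \<rightarrow>\<^sub>E P. measure M (name_set M act F A) * ln (measure M (name_set M act F A)))"
    by (rule sum.mono_neutral_left) (use fin in auto)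
  finally show ?thesis
    by (simp add: partition_entropy_def)
qed

lemma name_set_measurable:
  assumes F: "finite F" and P: "P \<subseteq> sets M" and act: "\<And>g. g \<in> F \<Longrightarrow> act g \<in> measurable M M"
    and A: "A \<in> F \<rightarrow>\<^sub>E P"
  shows "name_set M act F A \<in> sets M"
proof -
  have "{x \<in> space M. act g x \<in> A g} \<in> sets M" if "g \<in> F" for g
  proof -
    have "A g \<in> sets M" using A P that by auto
    from measurable_sets[OF act[OF that] this] show ?thesis
      by (simp add: vimage_def Int_def conj_commute)
  qed
  then show ?thesis
    unfolding name_set_def using F by (intro sets.sets_Collect_finite_All) auto
qed

text \<open>Gibbs' inequality in the form used for codes: if \<open>- ln (q A)\<close> is the length of the code word
  for the name \<open>A\<close>, then the expected code length bounds the entropy. The function \<open>s\<close> bounds the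
  length pointwise.\<close>

lemma entropy_action_join_le_integral:
  assumes M: "prob_space M" and P: "finite_measurable_partition M P" and F: "finite F"
    and act: "\<And>g. g \<in> F \<Longrightarrow> act g \<in> measurable M M"
    and q: "\<And>A. A \<in> F \<rightarrow>\<^sub>E P \<Longrightarrow> 0 < q A" "sum q (F \<rightarrow>\<^sub>E P) \<le> 1"
    and s: "integrable M s"
      "\<And>A x. A \<in> F \<rightarrow>\<^sub>E P \<Longrightarrow> x \<in> name_set M act F A \<Longrightarrow> - ln (q A) \<le> s x"
  shows "partition_entropy M (action_join M act F P) \<le> (\<integral>x. s x \<partial>M)"
proof -
  interpret prob_space M by fact
  have P': "finite P" "P \<subseteq> sets M" "partition_on (space M) P"
    using P by (auto simp: finite_measurable_partition_def)
  let ?I = "F \<rightarrow>\<^sub>E P" and ?D = "name_set M act F"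
  have fin: "finite ?I"
    using P' F by (simp add: finite_PiE)
  have meas: "?D A \<in> sets M" if "A \<in> ?I" for A
    using name_set_measurable[OF F P'(2) act that] .
  have ex: "\<exists>A\<in>?I. x \<in> ?D A" if "x \<in> space M" for x
    using that by (intro name_set_exists[OF P'(3)]) (auto dest: measurable_space[OF act])
  have disj: "disjoint_family_on ?D ?I"
    unfolding disjoint_family_on_def
  proof (intro ballI impI)
    fix A B assume "A \<in> ?I" "B \<in> ?I" "A \<noteq> B"
    then show "?D A \<inter> ?D B = {}"
      using name_set_unique[OF P'(3), of A F _ act B] by blast
  qed
  have int: "integrable M (indicat_real (?D A))" if "A \<in> ?I" for A
    using meas[OF that] by (simp add: emeasure_eq_measure)
  have total: "(\<Sum>A\<in>?I. prob (?D A)) = 1"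
  proof -
    have "(\<Union>A\<in>?I. ?D A) = space M"
      using ex by (auto simp: name_set_def)
    then show ?thesis
      using finite_measure_finite_Union[OF fin _ disj] meas by (simp add: image_subset_iff prob_space)
  qed
  have "partition_entropy M (action_join M act F P) \<le> (\<Sum>A\<in>?I. prob (?D A) * - ln (q A))"
    unfolding partition_entropy_action_join[OF P'(3,1) F]
    using q total by (intro gibbs_inequality fin) auto
  also have "\<dots> = (\<integral>x. (\<Sum>A\<in>?I. indicator (?D A) x * - ln (q A)) \<partial>M)"
    using meas int by (subst Bochner_Integration.integral_sum)
      (auto intro!: sum.cong integrable_mult_left simp: sets.Int_space_eq2)
  also have "\<dots> \<le> (\<integral>x. s x \<partial>M)"
  proof (rule integral_mono)
    show "integrable M (\<lambda>x. \<Sum>A\<in>?I. indicator (?D A) x * - ln (q A))"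
      by (intro Bochner_Integration.integrable_sum integrable_mult_left int)
    show "(\<Sum>A\<in>?I. indicator (?D A) x * - ln (q A)) \<le> s x" if "x \<in> space M" for x
    proof -
      from ex[OF that] obtain B where B: "B \<in> ?I" "x \<in> ?D B" by blast
      have "(\<Sum>A\<in>?I. indicator (?D A) x * - ln (q A)) = (\<Sum>A\<in>{B}. indicator (?D A) x * - ln (q A))"
      proof (rule sum.mono_neutral_right[OF fin])
        show "\<forall>A\<in>?I - {B}. indicator (?D A) x * - ln (q A) = 0"
        proof
          fix A assume A: "A \<in> ?I - {B}"
          then have "x \<notin> ?D A"
            using name_set_unique[OF P'(3) _ _ B] by blast
          then show "indicator (?D A) x * - ln (q A) = 0" by simp
        qed
      qed (use B in simp)
      also have "\<dots> = - ln (q B)" using B by simp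
      also have "\<dots> \<le> s x" using s(2)[OF B] .
      finally show ?thesis .
    qed
  qed (rule s)
  finally show ?thesis .
qed

text \<open>The code behind this bound: choose a point \<open>c\<close> of the finite factor \<open>C\<close> uniformly, and given
  \<open>c\<close> choose the letters of the name independently, the letter at \<open>g\<close> being
  \<open>guess (\<sigma> g c)\<close> with weight about \<open>1 - \<delta>\<close> and any letter with the remaining weight
  \<open>\<delta>\<close> spread evenly. A point \<open>x\<close> pays \<open>ln (card C)\<close> for its image in the factor, at most
  \<open>- ln (1 - \<delta>)\<close> for each correct guess and at most \<open>ln (card P / \<delta>)\<close> for each wrong one.
  By invariance a guess is wrong with the same probability at each \<open>g\<close>.\<close>

lemma entropy_action_join_le_finite_factor:
  fixes \<delta> :: real
  assumes M: "prob_space M" and P: "finite_measurable_partition M P" and F: "finite F"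
    and act: "\<And>g. g \<in> F \<Longrightarrow> act g \<in> measurable M M"
    and inv: "\<And>g B. g \<in> F \<Longrightarrow> B \<in> sets M \<Longrightarrow> measure M (act g -` B \<inter> space M) = measure M B"
    and C: "finite C" and Z: "Z \<in> space M \<rightarrow> C"
    and equivariant: "\<And>g x. g \<in> F \<Longrightarrow> x \<in> space M \<Longrightarrow> Z (act g x) = \<sigma> g (Z x)"
    and guess: "\<And>c. guess c \<in> P"
    and error: "{x \<in> space M. x \<notin> guess (Z x)} \<in> sets M"
    and \<delta>: "0 < \<delta>" "\<delta> < 1"
  shows "partition_entropy M (action_join M act F P) \<le> ln (card C) +
    card F * (- ln (1 - \<delta>) + ln (card P / \<delta>) * measure M {x \<in> space M. x \<notin> guess (Z x)})"
proof -
  interpret prob_space M by fact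
  have P': "finite P" "P \<subseteq> sets M" "partition_on (space M) P"
    using P by (auto simp: finite_measurable_partition_def)
  define E where "E = {x \<in> space M. x \<notin> guess (Z x)}"
  define k where "k = real (card P)"
  define N where "N = real (card C)"
  have "P \<noteq> {}" using guess by auto
  then have k: "k \<ge> 1" using P'(1) by (simp add: k_def Suc_le_eq card_gt_0_iff)
  have "C \<noteq> {}" using Z not_empty by auto
  then have N: "N \<ge> 1" using C by (simp add: N_def Suc_le_eq card_gt_0_iff)
  define w where "w B c = (if B = guess c then 1 - \<delta> else 0) + \<delta> / k" for B c
  have w_pos: "0 < w B c" for B c
    using \<delta> k by (auto simp: w_def intro!: add_pos_pos)
  have w_sum: "(\<Sum>B\<in>P. w B c) = 1" for c
  proof -
    have "(\<Sum>B\<in>P. w B c) = (\<Sum>B\<in>P. if B = guess c then 1 - \<delta> else 0) + k * (\<delta> / k)"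
      by (simp add: w_def sum.distrib k_def)
    also have "\<dots> = 1"
      using k P'(1) guess[of c] by (simp add: sum.delta)
    finally show ?thesis .
  qed
  define a where "a = - ln (1 - \<delta>)"
  define b where "b = ln (k / \<delta>)"
  have "a \<ge> 0" using \<delta> by (simp add: a_def)
  have "k / \<delta> \<ge> 1" using \<delta> k by (simp add: field_simps)
  then have "b \<ge> 0" by (simp add: b_def)
  have cost: "- ln (w B (Z y)) \<le> a + b * indicator E y" if "B \<in> P" "y \<in> B" for B y
  proof (cases "B = guess (Z y)")
    case True
    then have "1 - \<delta> \<le> w B (Z y)"
      using \<delta> k by (simp add: w_def)
    then have "ln (1 - \<delta>) \<le> ln (w B (Z y))"
      using \<delta> by simp
    moreover have "b * indicator E y \<ge> 0" using \<open>b \<ge> 0\<close> by simp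
    ultimately show ?thesis by (simp add: a_def)
  next
    case False
    have "y \<in> space M" using that P'(3) by (auto simp: partition_on_def)
    moreover have "y \<notin> guess (Z y)"
      using False that guess[of "Z y"] P'(3) unfolding partition_on_def disjoint_def by blast
    ultimately have "y \<in> E" by (simp add: E_def)
    then show ?thesis
      using False \<open>a \<ge> 0\<close> \<delta> k by (simp add: w_def b_def ln_div)
  qed
  define q where "q A = (\<Sum>c\<in>C. (\<Prod>g\<in>F. w (A g) (\<sigma> g c)) / N)" for A
  define s where "s x = ln N + (\<Sum>g\<in>F. a + b * indicator (act g -` E \<inter> space M) x)" for x
  have Em: "E \<in> sets M" using error by (simp add: E_def)
  have pre: "act g -` E \<inter> space M \<in> sets M" if "g \<in> F" for g
    using measurable_sets[OF act[OF that] Em] .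
  have int: "integrable M (indicat_real (act g -` E \<inter> space M))" if "g \<in> F" for g
    using pre[OF that] by (simp add: emeasure_eq_measure)
  have q_pos: "0 < q A" for A
    unfolding q_def using C \<open>C \<noteq> {}\<close> N
    by (intro sum_pos divide_pos_pos prod_pos w_pos) auto
  have "(\<Sum>A\<in>F \<rightarrow>\<^sub>E P. q A) = (\<Sum>c\<in>C. (\<Sum>A\<in>F \<rightarrow>\<^sub>E P. \<Prod>g\<in>F. w (A g) (\<sigma> g c)) / N)"
    unfolding q_def by (subst sum.swap) (simp add: sum_divide_distrib)
  also have "\<dots> = (\<Sum>c\<in>C. (\<Prod>g\<in>F. \<Sum>B\<in>P. w B (\<sigma> g c)) / N)"
    using F P'(1) by (simp add: prod_sum_PiE)
  also have "\<dots> = 1"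
    using N by (simp add: w_sum N_def)
  finally have q_sum: "(\<Sum>A\<in>F \<rightarrow>\<^sub>E P. q A) = 1" .
  have q_cost: "- ln (q A) \<le> s x" if A: "A \<in> F \<rightarrow>\<^sub>E P" and x: "x \<in> name_set M act F A" for A x
  proof -
    have xs: "x \<in> space M" using x by (simp add: name_set_def)
    let ?p = "\<Prod>g\<in>F. w (A g) (\<sigma> g (Z x))"
    have p_pos: "?p > 0" by (intro prod_pos w_pos)
    have "?p / N \<le> q A"
      unfolding q_def using Z xs C N w_pos
      by (intro member_le_sum) (auto intro!: divide_nonneg_nonneg prod_nonneg less_imp_le[OF w_pos])
    moreover have "?p / N > 0" using p_pos N by simp
    ultimately have "ln (?p / N) \<le> ln (q A)" by (simp add: q_pos)
    then have "- ln (q A) \<le> ln N - ln ?p"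
      using p_pos N by (simp add: ln_div)
    also have "ln ?p = (\<Sum>g\<in>F. ln (w (A g) (Z (act g x))))"
      using F w_pos xs equivariant by (subst ln_prod) (auto simp: less_imp_neq[symmetric])
    also have "ln N - \<dots> = ln N + (\<Sum>g\<in>F. - ln (w (A g) (Z (act g x))))"
      by (simp add: sum_negf)
    also have "\<dots> \<le> ln N + (\<Sum>g\<in>F. a + b * indicator E (act g x))"
      using A x by (intro add_left_mono sum_mono cost) (auto simp: name_set_def)
    also have "\<dots> = s x"
      using xs by (simp add: s_def indicator_def)
    finally show ?thesis .
  qed
  have "integrable M s"
    unfolding s_def using int by (auto intro!: Bochner_Integration.integrable_add Bochner_Integration.integrable_sum)
  then have "partition_entropy M (action_join M act F P) \<le> (\<integral>x. s x \<partial>M)"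
    using q_pos q_sum q_cost by (intro entropy_action_join_le_integral[OF M P F act, where q = q]) auto
  also have "(\<integral>x. s x \<partial>M) = ln N + (\<Sum>g\<in>F. a + b * prob (act g -` E \<inter> space M))"
  proof -
    have 1: "integrable M (\<lambda>x. a + b * indicator (act g -` E \<inter> space M) x)" if "g \<in> F" for g
      using int[OF that] by simp
    have 2: "(\<integral>x. a + b * indicator (act g -` E \<inter> space M) x \<partial>M) = a + b * prob (act g -` E \<inter> space M)"
      if "g \<in> F" for g
      using pre[OF that] int[OF that] by (subst Bochner_Integration.integral_add) (auto simp: prob_space)
    show ?thesis unfolding s_def
      using 1 2 by (subst Bochner_Integration.integral_add)
        (auto simp: prob_space Bochner_Integration.integral_sum)
  qed
  also have "\<dots> = ln N + card F * (a + b * prob E)"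
    using inv Em by simp
  finally show ?thesis
    unfolding N_def a_def b_def k_def E_def .
qed

section \<open>Approximation by a generating algebra\<close>

text \<open>The sets that can be approximated form a \<open>\<sigma>\<close>-algebra containing \<open>\<A>\<close>. The only closure
  property that needs care is the one under countable unions: finite unions are approximable,
  and by continuity of the measure they exhaust a countable one up to small measure.\<close>

lemma (in finite_measure) approximation_by_generating_algebra:
  assumes alg: "algebra (space M) \<A>" and gen: "sets M = sigma_sets (space M) \<A>"
    and A: "A \<in> sets M" and "\<epsilon> > 0"
  shows "\<exists>B\<in>\<A>. measure M (sym_diff A B) < \<epsilon>"
proof -
  interpret algebra "space M" \<A> by fact
  have sub: "\<A> \<subseteq> sets M" using gen by auto
  define approx where "approx A \<longleftrightarrow> (\<forall>\<epsilon>>0. \<exists>B\<in>\<A>. measure M (sym_diff A B) < \<epsilon>)" for A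
  have union2: "approx (A \<union> B)"
    if "A \<in> sets M" "B \<in> sets M" "approx A" "approx B" for A B
    unfolding approx_def
  proof (intro allI impI)
    fix \<epsilon> :: real assume "\<epsilon> > 0"
    then have "\<epsilon> / 2 > 0" by simp
    with that obtain A' B' where *: "A' \<in> \<A>" "measure M (sym_diff A A') < \<epsilon> / 2"
      "B' \<in> \<A>" "measure M (sym_diff B B') < \<epsilon> / 2"
      unfolding approx_def by metis
    have "measure M (sym_diff (A \<union> B) (A' \<union> B')) \<le> measure M (sym_diff A A' \<union> sym_diff B B')"
      using that * sub by (intro finite_measure_mono) auto
    also have "\<dots> \<le> measure M (sym_diff A A') + measure M (sym_diff B B')"
      using that * sub by (intro measure_Un_le) auto
    also have "\<dots> < \<epsilon>" using * by simp
    finally show "\<exists>B'\<in>\<A>. measure M (sym_diff (A \<union> B) B') < \<epsilon>"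
      using * by (intro bexI[of _ "A' \<union> B'"]) auto
  qed
  have "A \<in> sigma_sets (space M) \<A>" using A gen by simp
  then have "A \<in> sets M \<and> approx A"
  proof (induction rule: sigma_sets.induct)
    case (Basic a)
    then show ?case using sub unfolding approx_def by (auto intro!: bexI[of _ a])
  next
    case Empty
    show ?case unfolding approx_def by (auto intro!: bexI[of _ "{}"])
  next
    case (Compl a)
    show ?case unfolding approx_def
    proof (intro conjI allI impI)
      show "space M - a \<in> sets M" using Compl by auto
      fix \<epsilon> :: real assume "\<epsilon> > 0"
      with Compl obtain B where B: "B \<in> \<A>" "measure M (sym_diff a B) < \<epsilon>"
        unfolding approx_def by blast
      have "sym_diff (space M - a) (space M - B) = sym_diff a B"
        using Compl sub B sets.sets_into_space by blast
      then show "\<exists>B\<in>\<A>. measure M (sym_diff (space M - a) B) < \<epsilon>"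
        using B by (intro bexI[of _ "space M - B"]) auto
    qed
  next
    case (Union a)
    let ?U = "\<lambda>n. \<Union>i\<le>n. a i"
    have fin: "?U n \<in> sets M \<and> approx (?U n)" for n
    proof (induction n)
      case (Suc n)
      have "?U (Suc n) = ?U n \<union> a (Suc n)" by (auto simp: atMost_Suc)
      then show ?case using Suc Union union2[of "?U n" "a (Suc n)"] by auto
    qed (use Union in auto)
    have UN: "(\<Union>n. ?U n) = (\<Union>i. a i)" by auto
    have meas: "(\<Union>i. a i) \<in> sets M" using Union by auto
    have "(\<lambda>n. measure M (?U n)) \<longlonglongrightarrow> measure M (\<Union>n. ?U n)"
      using fin by (intro finite_Lim_measure_incseq) (auto intro!: incseq_SucI simp: atMost_Suc)
    then have lim: "(\<lambda>n. measure M (?U n)) \<longlonglongrightarrow> measure M (\<Union>i. a i)"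
      unfolding UN .
    show ?case unfolding approx_def
    proof (intro conjI allI impI)
      fix \<epsilon> :: real assume "\<epsilon> > 0"
      then have "\<epsilon> / 2 > 0" by simp
      from LIMSEQ_D[OF lim this] obtain n where n: "\<bar>measure M (?U n) - measure M (\<Union>i. a i)\<bar> < \<epsilon> / 2"
        by auto
      from fin[of n] \<open>\<epsilon> / 2 > 0\<close> obtain B where B: "B \<in> \<A>" "measure M (sym_diff (?U n) B) < \<epsilon> / 2"
        unfolding approx_def by blast
      have "measure M (sym_diff (\<Union>i. a i) B) \<le> measure M (((\<Union>i. a i) - ?U n) \<union> sym_diff (?U n) B)"
        using B sub fin[of n] meas by (intro finite_measure_mono) auto
      also have "\<dots> \<le> measure M ((\<Union>i. a i) - ?U n) + measure M (sym_diff (?U n) B)"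
        using B sub fin[of n] meas by (intro measure_Un_le) auto
      also have "measure M ((\<Union>i. a i) - ?U n) = measure M (\<Union>i. a i) - measure M (?U n)"
        using fin[of n] meas by (intro finite_measure_Diff) auto
      finally have "measure M (sym_diff (\<Union>i. a i) B) < \<epsilon>"
        using B(2) n by linarith
      then show "\<exists>B\<in>\<A>. measure M (sym_diff (\<Union>i. a i) B) < \<epsilon>"
        using B(1) by blast
    qed (rule meas)
  qed
  then show ?thesis using \<open>\<epsilon> > 0\<close> unfolding approx_def by blast
qed

section \<open>Folner sequences\<close>

text \<open>Enumerate the group and let the \<open>n\<close>-th member be invariant up to \<open>1 / (n + 1)\<close> under the
  first \<open>n + 1\<close> elements.\<close>

lemma (in group) folner_sequence_exists:
  assumes "countable (carrier G)" and "amenable G"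
  shows "\<exists>F. folner_sequence G F"
proof -
  define K where "K n = from_nat_into (carrier G) ` {..n}" for n :: nat
  have "carrier G \<noteq> {}" by auto
  then have K: "finite (K n) \<and> K n \<subseteq> carrier G" for n
    by (auto simp: K_def intro: from_nat_into)
  have "\<exists>F. finite F \<and> F \<noteq> {} \<and> F \<subseteq> carrier G \<and>
      (\<forall>g\<in>K n. real (card (sym_diff (g <# F) F)) \<le> inverse (real (Suc n)) * real (card F))" for n
    using assms(2)[unfolded amenable_def, rule_format, of "K n" "inverse (real (Suc n))"] K[of n]
    by auto
  then obtain F where F: "finite (F n)" "F n \<noteq> {}" "F n \<subseteq> carrier G"
      "\<And>g. g \<in> K n \<Longrightarrow> real (card (sym_diff (g <# F n) (F n))) \<le> inverse (real (Suc n)) * real (card (F n))"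
    for n by metis
  have "(\<lambda>n. real (card (sym_diff (g <# F n) (F n))) / real (card (F n))) \<longlonglongrightarrow> 0"
    if g: "g \<in> carrier G" for g
  proof (rule tendsto_sandwich[OF _ _ tendsto_const LIMSEQ_inverse_real_of_nat])
    obtain i where i: "g = from_nat_into (carrier G) i"
      using g assms(1) by (metis from_nat_into_surj)
    show "\<forall>\<^sub>F n in sequentially. real (card (sym_diff (g <# F n) (F n))) / real (card (F n)) \<le> inverse (real (Suc n))"
    proof (rule eventually_sequentiallyI[of i])
      fix n assume "i \<le> n"
      then have "g \<in> K n" by (auto simp: K_def i)
      moreover have "card (F n) > 0" using F(1,2)[of n] by (simp add: card_gt_0_iff)
      ultimately show "real (card (sym_diff (g <# F n) (F n))) / real (card (F n)) \<le> inverse (real (Suc n))"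
        using F(4)[of g n] by (subst pos_divide_le_eq) auto
    qed
  qed simp
  with F(1-3) have "folner_sequence G F"
    unfolding folner_sequence_def by simp
  then show ?thesis by blast
qed

text \<open>If \<open>card (F n)\<close> is less than \<open>k\<close>, the proportion
  \<open>card (sym_diff (g <# F n) (F n)) / card (F n)\<close> is either \<open>0\<close> or more than \<open>1 / k\<close>, so late
  members with fewer than \<open>k\<close> elements are invariant under any prescribed \<open>k\<close> elements of the
  group. Such a member contains \<open>k\<close> translates of one of its points, which is absurd.\<close>

lemma (in group) folner_sequence_card_at_top:
  assumes inf: "infinite (carrier G)" and F: "folner_sequence G F"
  shows "filterlim (\<lambda>n. real (card (F n))) at_top sequentially"
proof -
  have F': "finite (F n)" "F n \<noteq> {}" "F n \<subseteq> carrier G" for n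
    using F by (auto simp: folner_sequence_def)
  have "\<forall>\<^sub>F n in sequentially. k \<le> card (F n)" for k :: nat
  proof -
    obtain K where K: "finite K" "card K = k" "K \<subseteq> carrier G"
      using infinite_arbitrarily_large[OF inf] by blast
    have "\<forall>\<^sub>F n in sequentially. \<forall>g\<in>K. real (card (sym_diff (g <# F n) (F n))) / real (card (F n)) < inverse (Suc k)"
    proof (intro eventually_ball_finite K(1) ballI)
      fix g assume "g \<in> K"
      then have "(\<lambda>n. real (card (sym_diff (g <# F n) (F n))) / real (card (F n))) \<longlonglongrightarrow> 0"
        using F K(3) unfolding folner_sequence_def by blast
      then show "\<forall>\<^sub>F n in sequentially. real (card (sym_diff (g <# F n) (F n))) / real (card (F n)) < inverse (Suc k)"
        by (rule order_tendstoD(2)) simp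
    qed
    then show ?thesis
    proof eventually_elim
      fix n assume small: "\<forall>g\<in>K. real (card (sym_diff (g <# F n) (F n))) / real (card (F n)) < inverse (Suc k)"
      show "k \<le> card (F n)"
      proof (rule ccontr)
        assume "\<not> k \<le> card (F n)"
        then have lt: "card (F n) < k" by simp
        have pos: "card (F n) > 0" using F'[of n] by (simp add: card_gt_0_iff)
        have fixed: "g <# F n \<subseteq> F n" if "g \<in> K" for g
        proof -
          have "real (card (sym_diff (g <# F n) (F n))) < inverse (Suc k) * real (card (F n))"
            using small that pos by (subst (asm) pos_divide_less_eq) auto
          also have "\<dots> < 1" using lt by (simp add: field_simps)
          finally have "card (sym_diff (g <# F n) (F n)) = 0" by simp
          moreover have "finite (sym_diff (g <# F n) (F n))"
            using F'[of n] by (auto simp: l_coset_def)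
          ultimately show ?thesis by auto
        qed
        obtain f where f: "f \<in> F n" using F' by blast
        have "(\<lambda>g. g \<otimes> f) ` K \<subseteq> F n"
          using fixed f by (auto simp: l_coset_def)
        moreover have "inj_on (\<lambda>g. g \<otimes> f) K"
          using K f F'[of n] by (intro inj_onI) (auto dest: r_cancel)
        ultimately have "card K \<le> card (F n)"
          using F'(1)[of n] by (metis card_image card_mono)
        with K(2) lt show False by linarith
      qed
    qed
  qed
  then have "filterlim (\<lambda>n. card (F n)) at_top sequentially"
    by (simp add: filterlim_at_top)
  then show ?thesis
    by (rule filterlim_compose[OF filterlim_real_sequentially])
qed

section \<open>Odometers\<close>

locale odometer = group G for G (structure) +
  fixes \<Gamma> :: "nat \<Rightarrow> 'a set"
  assumes odometer_sequence: "odometer_sequence G \<Gamma>"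
begin

lemma normal_level: "\<Gamma> n \<lhd> G"
  using odometer_sequence by (simp add: odometer_sequence_def finite_index_normal_def)

lemma level_subset: "\<Gamma> n \<subseteq> carrier G"
  using normal_level by (metis normal_imp_subgroup subgroup.subset)

lemma finite_level_cosets: "finite (rcosets \<Gamma> n)"
  using odometer_sequence by (simp add: odometer_sequence_def finite_index_normal_def)

text \<open>In a finite group the sequence would be constant from a level of least cardinality on.\<close>

lemma infinite_carrier: "infinite (carrier G)"
proof
  assume fin: "finite (carrier G)"
  have dec: "\<Gamma> m \<subseteq> \<Gamma> n" if "n \<le> m" for m n
    using lift_Suc_antimono_le[OF _ that, of \<Gamma>] odometer_sequence
    by (auto simp: odometer_sequence_def)
  define c where "c n = card (\<Gamma> n)" for n
  obtain n where n: "\<And>m. c n \<le> c m"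
    using ex_has_least_nat[of "\<lambda>_. True" 0 c] by auto
  obtain m where m: "m > n" "\<Gamma> m \<noteq> \<Gamma> n"
    using odometer_sequence unfolding odometer_sequence_def by blast
  then have "\<Gamma> m \<subset> \<Gamma> n" using dec[of n m] by auto
  then have "c m < c n"
    unfolding c_def using finite_subset[OF level_subset fin] by (intro psubset_card_mono)
  with n[of m] show False by simp
qed

lemma coset_subset: "C \<in> rcosets (\<Gamma> n) \<Longrightarrow> C \<subseteq> carrier G"
  using level_subset[of n] by (auto simp: RCOSETS_def r_coset_def)

text \<open>Left translation commutes with the quotient maps because the levels are normal. This is what
  makes the action well defined on the inverse limit and its levels equivariant factors.\<close>

lemma translate_set_mult:
  assumes "g \<in> carrier G" "C \<subseteq> carrier G"
  shows "g <# (\<Gamma> n <#> C) = \<Gamma> n <#> (g <# C)"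
proof -
  interpret normal "\<Gamma> n" G by (rule normal_level)
  have "g <# (\<Gamma> n <#> C) = (g <# \<Gamma> n) <#> C"
    unfolding l_coset_eq_set_mult using assms level_subset by (simp add: set_mult_assoc)
  also have "g <# \<Gamma> n = \<Gamma> n #> g" using coset_eq assms by auto
  also have "(\<Gamma> n #> g) <#> C = \<Gamma> n <#> (g <# C)"
    unfolding l_coset_eq_set_mult r_coset_eq_set_mult using assms level_subset
    by (simp add: set_mult_assoc)
  finally show ?thesis .
qed

lemma translate_coset:
  assumes "g \<in> carrier G" "C \<in> rcosets (\<Gamma> n)"
  shows "g <# C \<in> rcosets (\<Gamma> n)"
proof -
  from assms obtain h where h: "h \<in> carrier G" "C = \<Gamma> n #> h" by (auto simp: RCOSETS_def)
  then have "C = \<Gamma> n <#> {h}" by (simp add: r_coset_eq_set_mult)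
  then have "g <# C = \<Gamma> n <#> (g <# {h})"
    using translate_set_mult assms h by simp
  also have "\<dots> = \<Gamma> n #> (g \<otimes> h)" by (simp add: r_coset_eq_set_mult l_coset_def)
  finally show ?thesis using assms h level_subset by (auto intro: rcosetsI)
qed

lemma carrier_FactGroup: "carrier (G Mod N) = rcosets N"
  by (simp add: FactGroup_def)

lemma odometer_space_coset:
  assumes "x \<in> odometer_space G \<Gamma>"
  shows "x n \<in> rcosets (\<Gamma> n)"
proof -
  have "x \<in> (\<Pi>\<^sub>E n\<in>UNIV. carrier (G Mod \<Gamma> n))"
    using assms unfolding odometer_space_def by blast
  then show ?thesis by (simp add: PiE_iff carrier_FactGroup)
qed

lemma odometer_space_step:
  assumes "x \<in> odometer_space G \<Gamma>"
  shows "x n = \<Gamma> n <#> x (Suc n)"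
  using assms unfolding odometer_space_def by blast

lemma odometer_space_subset: "x \<in> odometer_space G \<Gamma> \<Longrightarrow> x n \<subseteq> carrier G"
  using odometer_space_coset coset_subset by blast

lemma odometer_spaceI:
  assumes "\<And>n. x n \<in> rcosets (\<Gamma> n)" "\<And>n. x n = \<Gamma> n <#> x (Suc n)"
  shows "x \<in> odometer_space G \<Gamma>"
proof -
  have "x \<in> (\<Pi>\<^sub>E n\<in>UNIV. carrier (G Mod \<Gamma> n))"
    using assms(1) by (simp add: PiE_iff carrier_FactGroup)
  with assms(2) show ?thesis unfolding odometer_space_def by blast
qed

lemma odometer_space_agree:
  assumes "x \<in> odometer_space G \<Gamma>" "y \<in> odometer_space G \<Gamma>" and "n \<le> m" "x m = y m"
  shows "x n = y n"
  using assms(3,4)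
proof (induction rule: inc_induct)
  case (step n)
  then show ?case using assms(1,2) by (metis odometer_space_step)
qed

lemma odometer_action_closed:
  assumes g: "g \<in> carrier G" and x: "x \<in> odometer_space G \<Gamma>"
  shows "odometer_action G g x \<in> odometer_space G \<Gamma>"
proof (rule odometer_spaceI)
  fix n
  show "odometer_action G g x n \<in> rcosets (\<Gamma> n)"
    using translate_coset[OF g odometer_space_coset[OF x]] by (simp add: odometer_action_def)
  have "x n = \<Gamma> n <#> x (Suc n)" using odometer_space_step[OF x] .
  then show "odometer_action G g x n = \<Gamma> n <#> odometer_action G g x (Suc n)"
    using translate_set_mult[OF g odometer_space_subset[OF x]] by (simp add: odometer_action_def)
qed

lemma odometer_action_inv:
  assumes g: "g \<in> carrier G" and x: "x \<in> odometer_space G \<Gamma>"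
  shows "odometer_action G (inv g) (odometer_action G g x) = x"
    and "odometer_action G g (odometer_action G (inv g) x) = x"
  using odometer_space_subset[OF x] g
  by (auto simp: odometer_action_def lcos_m_assoc lcos_mult_one)

text \<open>\<open>S\<close> may contain sets that are not cosets of \<open>\<Gamma> n\<close>; this spares carrier conditions, for
  instance when forming complements.\<close>

definition cylinder :: "nat \<Rightarrow> 'a set set \<Rightarrow> (nat \<Rightarrow> 'a set) set" where
  "cylinder n S = {x \<in> odometer_space G \<Gamma>. x n \<in> S}"

lemma cylinder_refine:
  assumes "n \<le> m"
  shows "cylinder n S = cylinder m ((\<lambda>x. x m) ` cylinder n S)"
  using odometer_space_agree[OF _ _ assms] by (auto simp: cylinder_def) metis

text \<open>Two cylinders can be described at a common level since a coordinate determines all earlier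
  ones; at a fixed level the Boolean operations on cylinders are those on \<open>S\<close>.\<close>

lemma algebra_cylinders: "algebra (odometer_space G \<Gamma>) {cylinder n S |n S. True}"
  unfolding algebra_iff_Un
proof (intro conjI ballI)
  show "{cylinder n S |n S. True} \<subseteq> Pow (odometer_space G \<Gamma>)"
    by (auto simp: cylinder_def)
  have "{} = cylinder 0 {}" by (simp add: cylinder_def)
  then show "{} \<in> {cylinder n S |n S. True}" by blast
next
  fix A assume "A \<in> {cylinder n S |n S. True}"
  then obtain n S where "A = cylinder n S" by blast
  then have "odometer_space G \<Gamma> - A = cylinder n (- S)" by (auto simp: cylinder_def)
  then show "odometer_space G \<Gamma> - A \<in> {cylinder n S |n S. True}" by blast
next
  fix A B assume "A \<in> {cylinder n S |n S. True}" "B \<in> {cylinder n S |n S. True}"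
  then obtain n S m T where "A = cylinder n S" "B = cylinder m T" by blast
  then obtain S' T' where "A = cylinder (max n m) S'" "B = cylinder (max n m) T'"
    using cylinder_refine max.cobounded1 max.cobounded2 by metis
  then have "A \<union> B = cylinder (max n m) (S' \<union> T')" by (auto simp: cylinder_def)
  then show "A \<union> B \<in> {cylinder n S |n S. True}" by blast
qed

lemma topspace_odometer_topology: "topspace (odometer_topology G \<Gamma>) = odometer_space G \<Gamma>"
  unfolding odometer_topology_def using odometer_space_coset by (auto simp: PiE_iff carrier_FactGroup)

lemma openin_cylinder: "openin (odometer_topology G \<Gamma>) (cylinder n S)"
proof -
  let ?X = "product_topology (\<lambda>n. discrete_topology (carrier (G Mod \<Gamma> n))) UNIV"
  have "openin ?X {x \<in> topspace ?X. x n \<in> S \<inter> carrier (G Mod \<Gamma> n)}"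
    by (rule openin_continuous_map_preimage[OF continuous_map_product_projection[of n UNIV "\<lambda>n. discrete_topology (carrier (G Mod \<Gamma> n))"]])
       auto
  moreover have "cylinder n S = {x \<in> topspace ?X. x n \<in> S \<inter> carrier (G Mod \<Gamma> n)} \<inter> odometer_space G \<Gamma>"
    using odometer_space_coset by (auto simp: cylinder_def PiE_iff carrier_FactGroup)
  ultimately show ?thesis
    unfolding odometer_topology_def openin_subtopology by blast
qed

text \<open>A basic neighbourhood of \<open>x\<close> constrains only finitely many coordinates, and a coordinate
  beyond all of them determines them.\<close>

lemma openin_contains_cylinder:
  assumes U: "openin (odometer_topology G \<Gamma>) U" and x: "x \<in> U"
  shows "\<exists>m. cylinder m {x m} \<subseteq> U"
proof -
  let ?X = "product_topology (\<lambda>n. discrete_topology (carrier (G Mod \<Gamma> n))) UNIV"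
  from U obtain V where V: "openin ?X V" "U = V \<inter> odometer_space G \<Gamma>"
    unfolding odometer_topology_def openin_subtopology by blast
  with x have "x \<in> V" and xs: "x \<in> odometer_space G \<Gamma>" by auto
  with V(1) obtain W where W: "finite {i. W i \<noteq> carrier (G Mod \<Gamma> i)}" "x \<in> Pi\<^sub>E UNIV W" "Pi\<^sub>E UNIV W \<subseteq> V"
    unfolding openin_product_topology_alt by force
  obtain m where m: "\<And>i. W i \<noteq> carrier (G Mod \<Gamma> i) \<Longrightarrow> i \<le> m"
    using W(1) by (metis (mono_tags) finite_nat_set_iff_bounded_le mem_Collect_eq)
  have "y \<in> U" if y: "y \<in> cylinder m {x m}" for y
  proof -
    have ys: "y \<in> odometer_space G \<Gamma>" and eq: "y m = x m" using y by (auto simp: cylinder_def)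
    have "y i \<in> W i" for i
    proof (cases "i \<le> m")
      case True
      then have "y i = x i" using odometer_space_agree[OF ys xs _ eq] by simp
      then show ?thesis using W(2) by auto
    next
      case False
      then have "W i = carrier (G Mod \<Gamma> i)" using m by blast
      then show ?thesis using odometer_space_coset[OF ys] by (simp add: carrier_FactGroup)
    qed
    then have "y \<in> Pi\<^sub>E UNIV W" by auto
    then show ?thesis using W(3) V(2) ys by auto
  qed
  then show ?thesis by blast
qed

text \<open>An open set is the union of the one-coset cylinders inside it, and there are only countably
  many of these because each level has finitely many cosets.\<close>

lemma borel_eq_cylinders:
  "sigma_sets (odometer_space G \<Gamma>) {U. openin (odometer_topology G \<Gamma>) U} =
   sigma_sets (odometer_space G \<Gamma>) {cylinder n S |n S. True}"
proof (rule sigma_sets_eqI)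
  fix U assume "U \<in> {U. openin (odometer_topology G \<Gamma>) U}"
  then have U: "openin (odometer_topology G \<Gamma>) U" by simp
  define J where "J = (SIGMA m:UNIV. rcosets (\<Gamma> m))"
  define J' where "J' = {j \<in> J. cylinder (fst j) {snd j} \<subseteq> U}"
  have "countable J" unfolding J_def
    using finite_level_cosets by (intro countable_SIGMA) (auto intro: countable_finite)
  then have "countable J'" by (auto simp: J'_def intro: countable_subset)
  have "U \<subseteq> (\<Union>j\<in>J'. cylinder (fst j) {snd j})"
  proof
    fix x assume x: "x \<in> U"
    then obtain m where m: "cylinder m {x m} \<subseteq> U" using openin_contains_cylinder[OF U] by blast
    have "x \<in> odometer_space G \<Gamma>"
      using openin_subset[OF U] x by (auto simp: topspace_odometer_topology)
    then have "(m, x m) \<in> J'" "x \<in> cylinder m {x m}"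
      using m odometer_space_coset by (auto simp: J'_def J_def cylinder_def)
    then show "x \<in> (\<Union>j\<in>J'. cylinder (fst j) {snd j})" by force
  qed
  moreover have "(\<Union>j\<in>J'. cylinder (fst j) {snd j}) \<subseteq> U" by (auto simp: J'_def)
  ultimately have eq: "U = (\<Union>j\<in>J'. cylinder (fst j) {snd j})" by blast
  interpret sigma_algebra "odometer_space G \<Gamma>" "sigma_sets (odometer_space G \<Gamma>) {cylinder n S |n S. True}"
    by (rule sigma_algebra_sigma_sets) (auto simp: cylinder_def)
  show "U \<in> sigma_sets (odometer_space G \<Gamma>) {cylinder n S |n S. True}"
    unfolding eq using \<open>countable J'\<close>
    by (intro countable_UN') auto
next
  fix A assume "A \<in> {cylinder n S |n S. True}"
  then show "A \<in> sigma_sets (odometer_space G \<Gamma>) {U. openin (odometer_topology G \<Gamma>) U}"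
    using openin_cylinder by (auto intro: sigma_sets.Basic)
qed

text \<open>\<open>g\<close> acts as translation by its image \<open>(\<Gamma> n #> g)\<^sub>n\<close> in the inverse limit. Haar measure is
  thus invariant under the action.\<close>

lemma translation_eq_odometer_action:
  assumes g: "g \<in> carrier G" and A: "A \<subseteq> odometer_space G \<Gamma>"
  shows "(\<lambda>n. \<Gamma> n #> g) \<in> carrier (odometer_group G \<Gamma>)"
    and "(\<lambda>n. \<Gamma> n #> g) <#\<^bsub>odometer_group G \<Gamma>\<^esub> A = odometer_action G g ` A"
proof -
  let ?k = "\<lambda>n. \<Gamma> n #> g"
  have Suc: "\<Gamma> n <#> \<Gamma> (Suc n) = \<Gamma> n" for n
  proof
    interpret normal "\<Gamma> n" G by (rule normal_level)
    have sub: "\<Gamma> (Suc n) \<subseteq> \<Gamma> n"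
      using odometer_sequence by (simp add: odometer_sequence_def)
    then show "\<Gamma> n <#> \<Gamma> (Suc n) \<subseteq> \<Gamma> n" by (auto simp: set_mult_def)
    interpret S: normal "\<Gamma> (Suc n)" G by (rule normal_level)
    show "\<Gamma> n \<subseteq> \<Gamma> n <#> \<Gamma> (Suc n)"
    proof
      fix x assume "x \<in> \<Gamma> n"
      then show "x \<in> \<Gamma> n <#> \<Gamma> (Suc n)"
        using S.one_closed mem_carrier unfolding set_mult_def
        by (intro UN_I[of x] UN_I[of \<one>]) auto
    qed
  qed
  have "?k \<in> odometer_space G \<Gamma>"
  proof (rule odometer_spaceI)
    fix n
    show "\<Gamma> n #> g \<in> rcosets (\<Gamma> n)" using g level_subset by (intro rcosetsI)
    have "\<Gamma> n <#> (\<Gamma> (Suc n) #> g) = (\<Gamma> n <#> \<Gamma> (Suc n)) #> g"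
      using g level_subset by (simp add: setmult_rcos_assoc)
    then show "\<Gamma> n #> g = \<Gamma> n <#> (\<Gamma> (Suc n) #> g)" unfolding Suc by (rule sym)
  qed
  then show "?k \<in> carrier (odometer_group G \<Gamma>)"
    by (simp add: odometer_group_def)
  have "?k \<otimes>\<^bsub>odometer_group G \<Gamma>\<^esub> x = odometer_action G g x" if "x \<in> A" for x
  proof
    fix n
    have x: "x \<in> odometer_space G \<Gamma>" using that A by auto
    interpret normal "\<Gamma> n" G by (rule normal_level)
    have "\<Gamma> n <#> x n = x n"
      using odometer_space_coset[OF x, of n] by (rule rcosets_mult_eq)
    then have "\<Gamma> n <#> (g <# x n) = g <# x n"
      using translate_set_mult[OF g odometer_space_subset[OF x, of n], of n] by simp
    moreover have "(\<Gamma> n #> g) <#> x n = \<Gamma> n <#> (g <# x n)"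
      unfolding l_coset_eq_set_mult r_coset_eq_set_mult
      using g level_subset odometer_space_subset[OF x] by (simp add: set_mult_assoc)
    ultimately show "(?k \<otimes>\<^bsub>odometer_group G \<Gamma>\<^esub> x) n = odometer_action G g x n"
      by (simp add: odometer_group_def product_group_def FactGroup_def odometer_action_def)
  qed
  then show "?k <#\<^bsub>odometer_group G \<Gamma>\<^esub> A = odometer_action G g ` A"
    unfolding l_coset_def by (simp add: UNION_singleton_eq_range cong: image_cong)
qed

end

locale haar_odometer = odometer G \<Gamma> + prob_space \<mu>
  for G :: "('a, 'b) monoid_scheme" (structure)
    and \<Gamma> and \<mu> :: "(nat \<Rightarrow> 'a set) measure" +
  assumes haar: "haar_probability (odometer_group G \<Gamma>) (odometer_topology G \<Gamma>) \<mu>"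
begin

lemma space_eq: "space \<mu> = odometer_space G \<Gamma>"
  using haar by (simp add: haar_probability_def topspace_odometer_topology)

lemma sets_eq: "sets \<mu> = sigma_sets (odometer_space G \<Gamma>) {cylinder n S |n S. True}"
  using haar by (simp add: haar_probability_def topspace_odometer_topology borel_eq_cylinders)

lemma cylinder_measurable: "cylinder n S \<in> sets \<mu>"
  unfolding sets_eq by (auto intro: sigma_sets.Basic)

lemma odometer_action_measurable:
  assumes g: "g \<in> carrier G"
  shows "odometer_action G g \<in> measurable \<mu> \<mu>"
proof (rule measurable_sigma_sets[OF sets_eq])
  show "{cylinder n S |n S. True} \<subseteq> Pow (odometer_space G \<Gamma>)"
    by (auto simp: cylinder_def)
  show "odometer_action G g \<in> space \<mu> \<rightarrow> odometer_space G \<Gamma>"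
    using odometer_action_closed[OF g] by (auto simp: space_eq)
  fix A assume "A \<in> {cylinder n S |n S. True}"
  then obtain n S where "A = cylinder n S" by blast
  then have "odometer_action G g -` A \<inter> space \<mu> = cylinder n {C. g <# C \<in> S}"
    using odometer_action_closed[OF g]
    by (auto simp: cylinder_def space_eq) (auto simp: odometer_action_def)
  then show "odometer_action G g -` A \<inter> space \<mu> \<in> sets \<mu>"
    using cylinder_measurable by simp
qed

text \<open>The Haar property speaks of images of sets under translations; a preimage under \<open>g\<close> is an
  image under \<open>inv g\<close>.\<close>

lemma odometer_action_measure_preserving:
  assumes g: "g \<in> carrier G" and B: "B \<in> sets \<mu>"
  shows "measure \<mu> (odometer_action G g -` B \<inter> space \<mu>) = measure \<mu> B"
proof -
  have sub: "B \<subseteq> odometer_space G \<Gamma>"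
    using sets.sets_into_space[OF B] by (simp add: space_eq)
  have ig: "inv g \<in> carrier G" using g by simp
  have "odometer_action G g -` B \<inter> space \<mu> = odometer_action G (inv g) ` B"
  proof (intro equalityI subsetI)
    fix x assume "x \<in> odometer_action G g -` B \<inter> space \<mu>"
    then have "odometer_action G g x \<in> B" "x = odometer_action G (inv g) (odometer_action G g x)"
      using odometer_action_inv[OF g] by (auto simp: space_eq)
    then show "x \<in> odometer_action G (inv g) ` B" by blast
  next
    fix x assume "x \<in> odometer_action G (inv g) ` B"
    then obtain y where y: "y \<in> B" "x = odometer_action G (inv g) y" by blast
    then show "x \<in> odometer_action G g -` B \<inter> space \<mu>"
      using odometer_action_inv(2)[OF g, of y] odometer_action_closed[OF ig, of y] sub
      by (auto simp: space_eq)
  qed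
  also have "measure \<mu> (odometer_action G (inv g) ` B) = measure \<mu> B"
    using haar B translation_eq_odometer_action[OF ig sub]
    unfolding haar_probability_def measure_def by metis
  finally show ?thesis .
qed

end

section \<open>Vanishing of the entropy\<close>

context haar_odometer
begin

text \<open>Each member \<open>A\<close> of \<open>P\<close> is approximated by a cylinder \<open>B\<^sub>A\<close>, all of them at one level \<open>m\<close>. The
  guess picks an \<open>A\<close> with \<open>x \<in> B\<^sub>A\<close> whenever there is one; if \<open>x\<close> lies in \<open>A\<close> and the
  guess is wrong, then \<open>x\<close> lies outside \<open>B\<^sub>A\<close>, or inside the cylinder of the wrongly guessed
  member. Either way it lies in one of the small symmetric differences.\<close>

lemma partition_predictable_from_level:
  assumes P: "finite_measurable_partition \<mu> P" and "\<eta> > 0"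
  shows "\<exists>m guess. (\<forall>C. guess C \<in> P) \<and> {x \<in> space \<mu>. x \<notin> guess (x m)} \<in> sets \<mu> \<and>
    measure \<mu> {x \<in> space \<mu>. x \<notin> guess (x m)} < \<eta>"
proof -
  have P': "finite P" "P \<subseteq> sets \<mu>" "\<Union>P = space \<mu>" "disjoint P"
    using P by (auto simp: finite_measurable_partition_def partition_on_def)
  have "P \<noteq> {}" using P'(3) not_empty by auto
  then have k: "card P > 0" using P'(1) by (simp add: card_gt_0_iff)
  have "\<exists>n S. measure \<mu> (sym_diff A (cylinder n S)) < \<eta> / card P" if "A \<in> P" for A
  proof -
    have "\<exists>B\<in>{cylinder n S |n S. True}. measure \<mu> (sym_diff A B) < \<eta> / card P"
      using algebra_cylinders sets_eq that P'(2) \<open>\<eta> > 0\<close> k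
      by (intro approximation_by_generating_algebra) (auto simp: space_eq)
    then show ?thesis by blast
  qed
  then obtain n S where nS: "\<And>A. A \<in> P \<Longrightarrow> measure \<mu> (sym_diff A (cylinder (n A) (S A))) < \<eta> / card P"
    by metis
  define m where "m = Max (n ` P)"
  define T where "T A = (\<lambda>x. x m) ` cylinder (n A) (S A)" for A
  have approx: "measure \<mu> (sym_diff A (cylinder m (T A))) < \<eta> / card P" if "A \<in> P" for A
  proof -
    have "n A \<le> m" using that P'(1) by (simp add: m_def)
    from cylinder_refine[OF this, of "S A"] nS[OF that] show ?thesis by (simp add: T_def)
  qed
  have "\<exists>A\<in>P. (\<exists>B\<in>P. C \<in> T B) \<longrightarrow> C \<in> T A" for C
    using \<open>P \<noteq> {}\<close> by blast
  then obtain guess where guess: "\<And>C. guess C \<in> P" "\<And>B C. B \<in> P \<Longrightarrow> C \<in> T B \<Longrightarrow> C \<in> T (guess C)"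
    by metis
  let ?E = "{x \<in> space \<mu>. x \<notin> guess (x m)}"
  have "?E = space \<mu> - (\<Union>A\<in>P. A \<inter> cylinder m {C. guess C = A})"
    using guess(1) by (auto simp: cylinder_def space_eq)
  moreover have "A \<inter> cylinder m {C. guess C = A} \<in> sets \<mu>" if "A \<in> P" for A
    using that P'(2) cylinder_measurable by blast
  ultimately have meas: "?E \<in> sets \<mu>"
    using P'(1) by (metis (no_types, lifting) sets.finite_UN sets.compl_sets)
  have "?E \<subseteq> (\<Union>A\<in>P. sym_diff A (cylinder m (T A)))"
  proof
    fix x assume x: "x \<in> ?E"
    then obtain A where A: "A \<in> P" "x \<in> A" using P'(3) by auto
    have mem: "x \<in> cylinder m (T B) \<longleftrightarrow> x m \<in> T B" for B
      using x by (simp add: cylinder_def space_eq)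
    show "x \<in> (\<Union>A\<in>P. sym_diff A (cylinder m (T A)))"
    proof (cases "x m \<in> T A")
      case True
      then have "x m \<in> T (guess (x m))" using guess(2) A by blast
      then have "x \<in> sym_diff (guess (x m)) (cylinder m (T (guess (x m))))" using x mem by simp
      then show ?thesis using guess(1) by blast
    next
      case False
      then have "x \<in> sym_diff A (cylinder m (T A))" using A mem by simp
      then show ?thesis using A by blast
    qed
  qed
  moreover have sd: "sym_diff A (cylinder m (T A)) \<in> sets \<mu>" if "A \<in> P" for A
    using that P'(2) cylinder_measurable by blast
  ultimately have "measure \<mu> ?E \<le> measure \<mu> (\<Union>A\<in>P. sym_diff A (cylinder m (T A)))"
    using P'(1) by (intro finite_measure_mono sets.finite_UN) auto
  also have "\<dots> \<le> (\<Sum>A\<in>P. measure \<mu> (sym_diff A (cylinder m (T A))))"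
    using sd P'(1) by (intro measure_UNION_le)
  also have "\<dots> < (\<Sum>A\<in>P. \<eta> / card P)"
    using approx P'(1) \<open>P \<noteq> {}\<close> by (intro sum_strict_mono)
  also have "\<dots> = \<eta>" using k by simp
  finally show ?thesis using meas guess(1) by blast
qed

lemma entropy_rate_tendsto_0:
  assumes P: "finite_measurable_partition \<mu> P" and F: "folner_sequence G F"
  shows "(\<lambda>n. partition_entropy \<mu> (action_join \<mu> (odometer_action G) (F n) P) / real (card (F n)))
    \<longlonglongrightarrow> 0"
proof (rule tendstoI)
  fix \<epsilon> :: real assume \<epsilon>: "\<epsilon> > 0"
  have F': "finite (F n)" "F n \<noteq> {}" "F n \<subseteq> carrier G" for n
    using F by (auto simp: folner_sequence_def)
  \<comment> \<open>The three thirds of \<open>\<epsilon>\<close> go to the correct guesses (by the choice of \<open>\<delta>\<close>), to the wrong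
    guesses (by the choice of \<open>\<eta>\<close>), and to the point of the finite factor (by the size of \<open>F n\<close>).
    The level \<open>m\<close> depends on \<open>\<delta>\<close>, since a smaller \<open>\<delta>\<close> makes an error more expensive.\<close>
  define \<delta> where "\<delta> = 1 - exp (- \<epsilon> / 3)"
  have \<delta>: "0 < \<delta>" "\<delta> < 1" "- ln (1 - \<delta>) = \<epsilon> / 3" using \<epsilon> by (auto simp: \<delta>_def)
  define L where "L = ln (card P / \<delta>)"
  define \<eta> where "\<eta> = \<epsilon> / (3 * (\<bar>L\<bar> + 1))"
  have "\<eta> > 0" using \<epsilon> by (simp add: \<eta>_def)
  from partition_predictable_from_level[OF P this] obtain m guess where guess: "\<And>C. guess C \<in> P"
    "{x \<in> space \<mu>. x \<notin> guess (x m)} \<in> sets \<mu>"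
    "measure \<mu> {x \<in> space \<mu>. x \<notin> guess (x m)} < \<eta>"
    by blast
  let ?E = "{x \<in> space \<mu>. x \<notin> guess (x m)}"
  define N where "N = card (rcosets (\<Gamma> m))"
  have "L * measure \<mu> ?E \<le> \<bar>L\<bar> * \<eta>"
    using guess(3) by (intro mult_mono) auto
  also have "\<dots> \<le> \<epsilon> / 3"
    using \<epsilon> by (simp add: \<eta>_def field_simps)
  finally have L: "L * measure \<mu> ?E \<le> \<epsilon> / 3" .
  have bound: "partition_entropy \<mu> (action_join \<mu> (odometer_action G) (F n) P) \<le>
      ln N + card (F n) * (\<epsilon> / 3 + \<epsilon> / 3)" for n
  proof -
    have "partition_entropy \<mu> (action_join \<mu> (odometer_action G) (F n) P) \<le>
        ln N + card (F n) * (- ln (1 - \<delta>) + L * measure \<mu> ?E)"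
      unfolding N_def L_def
    proof (rule entropy_action_join_le_finite_factor[where \<sigma> = "l_coset G"])
      show "(\<lambda>x. x m) \<in> space \<mu> \<rightarrow> rcosets (\<Gamma> m)"
        using odometer_space_coset by (simp add: space_eq)
    next
      fix g assume "g \<in> F n"
      then have g: "g \<in> carrier G" using F' by blast
      show "odometer_action G g \<in> measurable \<mu> \<mu>"
        using g by (rule odometer_action_measurable)
      show "measure \<mu> (odometer_action G g -` B \<inter> space \<mu>) = measure \<mu> B" if "B \<in> sets \<mu>" for B
        using g that by (rule odometer_action_measure_preserving)
      show "odometer_action G g x m = g <# x m" for x
        by (simp add: odometer_action_def)
    qed (fact prob_space_axioms P F' finite_level_cosets guess \<delta>)+
    also have "\<dots> \<le> ln N + card (F n) * (\<epsilon> / 3 + \<epsilon> / 3)"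
      using L \<delta>(3) by (intro add_left_mono mult_left_mono) auto
    finally show ?thesis .
  qed
  have "(\<lambda>n. ln N / real (card (F n))) \<longlonglongrightarrow> 0"
    by (rule real_tendsto_divide_at_top[OF tendsto_const folner_sequence_card_at_top[OF infinite_carrier F]])
  then have "\<forall>\<^sub>F n in sequentially. ln N / real (card (F n)) < \<epsilon> / 3"
    by (rule order_tendstoD(2)) (use \<epsilon> in simp)
  then show "\<forall>\<^sub>F n in sequentially.
      dist (partition_entropy \<mu> (action_join \<mu> (odometer_action G) (F n) P) / real (card (F n))) 0 < \<epsilon>"
  proof eventually_elim
    fix n assume n: "ln N / real (card (F n)) < \<epsilon> / 3"
    let ?h = "partition_entropy \<mu> (action_join \<mu> (odometer_action G) (F n) P)"
    have pos: "real (card (F n)) > 0" using F'[of n] by (simp add: card_gt_0_iff)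
    have "?h / card (F n) \<le> (ln N + card (F n) * (\<epsilon> / 3 + \<epsilon> / 3)) / card (F n)"
      using bound pos by (intro divide_right_mono) auto
    also have "\<dots> = ln N / card (F n) + (\<epsilon> / 3 + \<epsilon> / 3)"
      using pos by (simp add: add_divide_distrib)
    also have "\<dots> < \<epsilon>" using n by linarith
    finally have "?h / card (F n) < \<epsilon>" .
    moreover have "0 \<le> ?h / card (F n)"
      using partition_entropy_nonneg[OF prob_space_axioms] by simp
    ultimately show "dist (?h / real (card (F n))) 0 < \<epsilon>" by (simp only: dist_real_def)
  qed
qed

end

theorem corollary5p4:
  fixes G :: "('a, 'b) monoid_scheme"
    and \<Gamma> :: "nat \<Rightarrow> 'a set"
    and \<mu> :: "(nat \<Rightarrow> 'a set) measure"
  assumes "group G"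
    and "finitely_generated G"
    and "residually_finite G"
    and "countable (carrier G)"
    and "amenable G"
    and "odometer_sequence G \<Gamma>"
    and "haar_probability (odometer_group G \<Gamma>) (odometer_topology G \<Gamma>) \<mu>"
  shows "action_entropy G \<mu> (odometer_action G) = 0"
proof -
  interpret group G by fact
  interpret prob_space \<mu> using assms(7) by (simp add: haar_probability_def)
  interpret haar_odometer G \<Gamma> \<mu> by unfold_locales fact+
  \<comment> \<open>Without a Folner sequence the limit would not be unique.\<close>
  obtain F where F: "folner_sequence G F"
    using folner_sequence_exists assms(4,5) by blast
  have zero: "partition_action_entropy G \<mu> (odometer_action G) P = 0"
    if P: "finite_measurable_partition \<mu> P" for P
    unfolding partition_action_entropy_def
  proof (rule the_equality)
    fix h
    assume "\<forall>F. folner_sequence G F \<longrightarrow>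
      (\<lambda>n. partition_entropy \<mu> (action_join \<mu> (odometer_action G) (F n) P) / real (card (F n))) \<longlonglongrightarrow> h"
    then show "h = 0"
      using LIMSEQ_unique[OF _ entropy_rate_tendsto_0[OF P F]] F by blast
  qed (use entropy_rate_tendsto_0[OF P] in blast)
  \<comment> \<open>Some partition is needed: in the extended reals the supremum of the empty set is \<open>-\<infinity>\<close>.\<close>
  have "finite_measurable_partition \<mu> {space \<mu>}"
    using not_empty by (auto simp: finite_measurable_partition_def partition_on_def)
  then have "{P. finite_measurable_partition \<mu> P} \<noteq> {}" by blast
  moreover have "action_entropy G \<mu> (odometer_action G) =
      (SUP P\<in>{P. finite_measurable_partition \<mu> P}. 0)"
    unfolding action_entropy_def by (intro SUP_cong) (auto simp: zero zero_ereal_def)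
  ultimately show ?thesis by simp
qed

end
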